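(* Let $\Omega\subset\mathbb{R}^3$ be an open, bounded and connected set with a regular (Lipschitzian) boundary $\partial\Omega$, let $\alpha,\beta,\gamma$ be positive real constants, $U=W_0^{1,2}(\Omega)$, $f\in L^2(\Omega)$, all spaces and operators being understood in the finite-dimensional discretized sense described in the context. Let $J:U\to\mathbb{R}$, $$J(u)=\frac\gamma2\int_\Omega\nabla u\cdot\nabla u\,dx+\frac\alpha2\int_\Omega(u^2-\beta)^2dx-\langle u,f\rangle_{L^2},$$ and assume $-\gamma\nabla^2-2\alpha\beta<\mathbf{0}$ in an appropriate matrix sense for the finite-dimensional approximation. Define $$F(u)=\frac\gamma2\int_\Omega\nabla u\cdot\nabla u\,dx+\frac K2\int_\Omega u^2dx,\qquad G(u,v)=-\frac\alpha2\int_\Omega(u^2-\beta+v)^2dx+\frac K2\int_\Omega u^2dx+\langle u,f\rangle_{L^2},$$ so that $J(u)=F(u)-G(u,0)$, and $$F^*(v_1^* )=\sup_{u\in U}\{\langle u,v_1^*\rangle_{L^2}-F(u)\}=\frac12\int_\Omega\frac{(v_1^* )^2}{K-\gamma\nabla^2}\,dx,$$ $$G^*(v_1^*,v_0^* )=\sup_{u\in U}\inf_{v\in L^2}\{\langle u,v_1^*\rangle_{L^2}-\langle v,v_0^*\rangle_{L^2}-G(u,v)\}=-\frac12\int_\Omega\frac{(v_1^*-f)^2}{2v_0^*-K}dx-\frac1{2\alpha}\int_\Omega(v_0^* )^2dx-\beta\int_\Omega v_0^*dx$$ if $-2v_0^*+K>0$ in $\overline\Omega$. Let $$C=\{v_0^*\in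 C(\overline\Omega):-2v_0^*+K>K/2\text{ in }\overline\Omega\},$$ where $K>0$ is such that $\frac1\alpha>\frac{8K_2^2}{K}$ for some appropriate $K_2>0$. Suppose $u_0\in U$ is such that $\delta J(u_0)=\mathbf 0$, $\|u_0\|_\infty\le K_2$ and $\delta^2J(u_0)>\mathbf{0}$. Define $$A^+=\{u\in U:u\,u_0\ge0\text{ in }\Omega\},\quad B^+=\{u\in U:\delta^2J(u)\ge\mathbf{0}\},\quad E=A^+\cap B^+,$$ $$\hat v_0^*=\alpha(u_0^2-\beta),\qquad\hat v_1^*=-\gamma\nabla^2u_0+Ku_0,$$ and assume also $\hat v_0^*\in C$. Denote $J^*(v_1^*,v_0^* )=-F^*(v_1^* )+G^*(v_1^*,v_0^* )$ and $J_1^*(v_1^* )=\sup_{v_0^*\in C}J^*(v_1^*,v_0^* )$. Then there exists $r>0$ such that $$J(u_0)=\inf_{u\in E}J(u)=\inf_{v_1^*\in B_r(\hat v_1^* )}J_1^*(v_1^* )=J_1^*(\hat v_1^* )=\inf_{v_1^*\in B_r(\hat v_1^* )}\Big\{\sup_{v_0^*\in C}J^*(v_1^*,v_0^* )\Big\}=J^*(\hat v_1^*,\hat v_0^* ).$$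
   Context: Finite-dimensional convention: the problem is considered in a finite-dimensional version, in a finite differences or finite elements context, with spaces and operators not relabeled. Functions are then vectors in $\mathbb{R}^n$ for some $n$ given by the discretization, products, squares and inequalities between functions being componentwise; $\nabla^2$ denotes the matrix of the discretized Laplacian (zero boundary values); $\int_\Omega\frac{v^2}{2v_0^*-K}dx$ means $v^T(2v_0^*-K\,I_d)^{-1}v$, where $I_d$ is the $n\times n$ identity and $2v_0^*-K\,I_d$ is the diagonal matrix with diagonal entries $2v_0^*(i)-K$; likewise $\int_\Omega\frac{v^2}{K-\gamma\nabla^2}dx$ means $v^T(K\,I_d-\gamma\nabla^2)^{-1}v$. Scalars in operator expressions mean multiples of the identity, and inequalities with $\mathbf 0$ between operators are matrix inequalities (definiteness or semidefiniteness). $\delta J$ and $\delta^2J$ are the first and second variations of $J$; $\delta^2J(u)=-\gamma\nabla^2+6\alpha u^2-2\alpha\beta$. $B_r(\cdot)$ is the ball of radius $r$. *)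

theory Defs
  imports "HOL-Analysis.Analysis"
begin

text \<open>
  Discretized functions are vectors in \<open>real ^ 'n\<close>, one component per unknown; the \<open>L\<^sup>2\<close> inner
  product is the inner product of \<open>real ^ 'n\<close>.

  A discretization enters through the matrix \<open>D\<close> of its discrete gradient (one row per difference
  quotient, or per component of an elementwise gradient), acting on the vector of interior unknowns
  with the zero boundary values already eliminated. Boundary values zero mean that only the zero
  function has zero gradient, i.e. that \<open>D\<close> is injective; this is assumed where it is needed.
\<close>

definition laplacian :: "real ^ 'n ^ 'm \<Rightarrow> real ^ 'n ^ 'n" where
  "laplacian D = - (transpose D ** D)"

lemma laplacian_integration_by_parts:
  "(D *v u) \<bullet> (D *v v) = - (u \<bullet> (laplacian D *v v))"
proof -
  have "u \<bullet> (laplacian D *v v) = - (u \<bullet> (transpose D *v (D *v v)))"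
    using matrix_vector_mult_diff_rdistrib[of 0 "transpose D ** D" v]
    by (simp add: laplacian_def matrix_vector_mul_assoc)
  also have "u \<bullet> (transpose D *v (D *v v)) = (D *v u) \<bullet> (D *v v)"
    by (metis dot_lmul_matrix inner_commute transpose_matrix_vector)
  finally show ?thesis by simp
qed

definition diag_mat :: "real ^ 'n \<Rightarrow> real ^ 'n ^ 'n" where
  "diag_mat d = (\<chi> i j. if i = j then d $ i else 0)"

text \<open>Matrix inequalities with \<open>0\<close>; they are only used for symmetric matrices.\<close>

definition pos_def :: "real ^ 'n ^ 'n \<Rightarrow> bool" where
  "pos_def A \<longleftrightarrow> (\<forall>x. x \<noteq> 0 \<longrightarrow> x \<bullet> (A *v x) > 0)"

definition pos_semidef :: "real ^ 'n ^ 'n \<Rightarrow> bool" where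
  "pos_semidef A \<longleftrightarrow> (\<forall>x. x \<bullet> (A *v x) \<ge> 0)"

definition neg_def :: "real ^ 'n ^ 'n \<Rightarrow> bool" where
  "neg_def A \<longleftrightarrow> (\<forall>x. x \<noteq> 0 \<longrightarrow> x \<bullet> (A *v x) < 0)"

definition first_variation :: "(real ^ 'n \<Rightarrow> real) \<Rightarrow> real ^ 'n \<Rightarrow> real ^ 'n \<Rightarrow> real" where
  "first_variation \<Phi> u h = deriv (\<lambda>t. \<Phi> (u + t *\<^sub>R h)) 0"

definition second_variation :: "(real ^ 'n \<Rightarrow> real) \<Rightarrow> real ^ 'n \<Rightarrow> real ^ 'n ^ 'n" where
  "second_variation \<Phi> u =
     (\<chi> i j. deriv (\<lambda>s. first_variation \<Phi> (u + s *\<^sub>R axis j 1) (axis i 1)) 0)"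

definition J :: "real \<Rightarrow> real \<Rightarrow> real \<Rightarrow> real ^ 'n ^ 'm \<Rightarrow> real ^ 'n \<Rightarrow> real ^ 'n \<Rightarrow> real" where
  "J \<alpha> \<beta> \<gamma> D f u =
     \<gamma> / 2 * ((D *v u) \<bullet> (D *v u)) + \<alpha> / 2 * (\<Sum>i\<in>UNIV. ((u $ i)\<^sup>2 - \<beta>)\<^sup>2) - u \<bullet> f"

definition F :: "real \<Rightarrow> real \<Rightarrow> real ^ 'n ^ 'm \<Rightarrow> real ^ 'n \<Rightarrow> real" where
  "F \<gamma> K D u = \<gamma> / 2 * ((D *v u) \<bullet> (D *v u)) + K / 2 * (u \<bullet> u)"

definition G :: "real \<Rightarrow> real \<Rightarrow> real \<Rightarrow> real ^ 'n \<Rightarrow> real ^ 'n \<Rightarrow> real ^ 'n \<Rightarrow> real" where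
  "G \<alpha> \<beta> K f u v =
     - \<alpha> / 2 * (\<Sum>i\<in>UNIV. ((u $ i)\<^sup>2 - \<beta> + v $ i)\<^sup>2) + K / 2 * (u \<bullet> u) + u \<bullet> f"

text \<open>
  Suprema and infima are taken in the extended reals, so that none of them has an unspecified value.
\<close>

definition F_star :: "real \<Rightarrow> real \<Rightarrow> real ^ 'n ^ 'm \<Rightarrow> real ^ 'n \<Rightarrow> ereal" where
  "F_star \<gamma> K D v1 = (SUP u. ereal (u \<bullet> v1 - F \<gamma> K D u))"

definition G_star :: "real \<Rightarrow> real \<Rightarrow> real \<Rightarrow> real ^ 'n \<Rightarrow> real ^ 'n \<Rightarrow> real ^ 'n \<Rightarrow> ereal" where
  "G_star \<alpha> \<beta> K f v1 v0 =
     (SUP u. INF v. ereal (u \<bullet> v1 - v \<bullet> v0 - G \<alpha> \<beta> K f u v))"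

definition C :: "real \<Rightarrow> (real ^ 'n) set" where
  "C K = {v0. \<forall>i. - 2 * v0 $ i + K > K / 2}"

definition J_star ::
  "real \<Rightarrow> real \<Rightarrow> real \<Rightarrow> real \<Rightarrow> real ^ 'n ^ 'm \<Rightarrow> real ^ 'n \<Rightarrow> real ^ 'n \<Rightarrow> real ^ 'n \<Rightarrow> ereal" where
  "J_star \<alpha> \<beta> \<gamma> K D f v1 v0 = - F_star \<gamma> K D v1 + G_star \<alpha> \<beta> K f v1 v0"

definition J1_star ::
  "real \<Rightarrow> real \<Rightarrow> real \<Rightarrow> real \<Rightarrow> real ^ 'n ^ 'm \<Rightarrow> real ^ 'n \<Rightarrow> real ^ 'n \<Rightarrow> ereal" where
  "J1_star \<alpha> \<beta> \<gamma> K D f v1 = (SUP v0 \<in> C K. J_star \<alpha> \<beta> \<gamma> K D f v1 v0)"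

definition A_plus :: "real ^ 'n \<Rightarrow> (real ^ 'n) set" where
  "A_plus u0 = {u. \<forall>i. u $ i * u0 $ i \<ge> 0}"

definition B_plus ::
  "real \<Rightarrow> real \<Rightarrow> real \<Rightarrow> real ^ 'n ^ 'm \<Rightarrow> real ^ 'n \<Rightarrow> (real ^ 'n) set" where
  "B_plus \<alpha> \<beta> \<gamma> D f = {u. pos_semidef (second_variation (J \<alpha> \<beta> \<gamma> D f) u)}"

text \<open>
  The variations of \<open>J\<close> have their usual closed forms.
\<close>

lemma J_has_first_variation:
  "((\<lambda>t. J \<alpha> \<beta> \<gamma> D f (u + t *\<^sub>R h)) has_field_derivative
     \<gamma> * ((D *v u) \<bullet> (D *v h)) + 2 * \<alpha> * (\<Sum>i\<in>UNIV. ((u $ i)\<^sup>2 - \<beta>) * u $ i * h $ i) - h \<bullet> f) (at 0)"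
proof -
  have eq: "J \<alpha> \<beta> \<gamma> D f (u + t *\<^sub>R h) =
      \<gamma> / 2 * ((D *v u) \<bullet> (D *v u) + 2 * t * ((D *v u) \<bullet> (D *v h)) + t\<^sup>2 * ((D *v h) \<bullet> (D *v h)))
      + \<alpha> / 2 * (\<Sum>i\<in>UNIV. ((u $ i + t * h $ i)\<^sup>2 - \<beta>)\<^sup>2) - (u \<bullet> f + t * (h \<bullet> f))" for t
    by (simp add: J_def matrix_vector_right_distrib matrix_vector_mult_scaleR inner_add_left
        inner_add_right inner_commute power2_eq_square algebra_simps)
  show ?thesis
    unfolding eq
    by (rule derivative_eq_intros refl | simp)+
       (simp add: sum_distrib_left algebra_simps)
qed

lemma first_variation_J:
  "first_variation (J \<alpha> \<beta> \<gamma> D f) u h =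
     \<gamma> * ((D *v u) \<bullet> (D *v h)) + 2 * \<alpha> * (\<Sum>i\<in>UNIV. ((u $ i)\<^sup>2 - \<beta>) * u $ i * h $ i) - h \<bullet> f"
  unfolding first_variation_def by (rule DERIV_imp_deriv[OF J_has_first_variation])

lemma second_variation_J:
  "second_variation (J \<alpha> \<beta> \<gamma> D f) u =
     - \<gamma> *\<^sub>R laplacian D + diag_mat (\<chi> i. 6 * \<alpha> * (u $ i)\<^sup>2) - mat (2 * \<alpha> * \<beta>)"
proof -
  have entry: "second_variation (J \<alpha> \<beta> \<gamma> D f) u $ i $ j =
      (- \<gamma> *\<^sub>R laplacian D + diag_mat (\<chi> i. 6 * \<alpha> * (u $ i)\<^sup>2) - mat (2 * \<alpha> * \<beta>)) $ i $ j" for i j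
  proof -
    let ?e = "\<lambda>k. axis k 1 :: real ^ 'a"
    have lap: "(D *v ?e j) \<bullet> (D *v ?e i) = - laplacian D $ i $ j"
      unfolding inner_commute[of "D *v axis j 1"]
      unfolding laplacian_integration_by_parts
      by (simp add: matrix_vector_mult_basis inner_axis' column_def)
    have sum_axis: "(\<Sum>k\<in>UNIV. g k * ?e i $ k) = g i" for g :: "'a \<Rightarrow> real"
      by (simp add: axis_def if_distrib cong: if_cong)
    have eq: "first_variation (J \<alpha> \<beta> \<gamma> D f) (u + s *\<^sub>R ?e j) (?e i) =
        \<gamma> * ((D *v u) \<bullet> (D *v ?e i) - s * laplacian D $ i $ j)
        + 2 * \<alpha> * (((u $ i + s * ?e j $ i)\<^sup>2 - \<beta>) * (u $ i + s * ?e j $ i)) - ?e i \<bullet> f" for s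
      unfolding first_variation_J sum_axis
      by (simp add: matrix_vector_right_distrib matrix_vector_mult_scaleR inner_add_left lap)
    have "((\<lambda>s. first_variation (J \<alpha> \<beta> \<gamma> D f) (u + s *\<^sub>R ?e j) (?e i)) has_field_derivative
        - \<gamma> * laplacian D $ i $ j + 2 * \<alpha> * (3 * (u $ i)\<^sup>2 - \<beta>) * ?e j $ i) (at 0)"
      unfolding eq
      by (rule derivative_eq_intros refl | simp)+
         (simp add: power2_eq_square algebra_simps)
    then show ?thesis
      by (simp add: second_variation_def DERIV_imp_deriv diag_mat_def mat_def axis_def algebra_simps)
  qed
  then show ?thesis
    by (simp only: vec_eq_iff) simp
qed

end

theory Submission
  imports Defs
begin

text \<open>
  Let \<open>M\<close> be the matrix \<open>2\<alpha>\<beta> + \<gamma> \<nabla>\<^sup>2\<close>, positive definite by assumption, so that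
  \<open>\<delta>\<^sup>2J(u) = diag (6\<alpha>u\<^sup>2) - M\<close>. On \<open>E\<close>, Taylor's formula at the critical point \<open>u0\<close> writes
  \<open>J(u) - J(u0)\<close> as a nonnegative combination of the forms \<open>diag (6\<alpha>u0\<^sup>2) - M\<close>,
  \<open>diag (6\<alpha>u\<^sup>2) - M\<close> and \<open>diag (6\<alpha> u0 u) - M\<close>. The first two are nonnegative by the definition of
  \<open>B_plus\<close>, hence so is the third by monotonicity of the geometric mean of matrices.

  On the dual side, with \<open>w = (K - \<gamma> \<nabla>\<^sup>2)\<^sup>-\<^sup>1 v1\<close> and \<open>v0 = \<alpha>(w\<^sup>2 - \<beta>)\<close> one has
  \<open>J_star v1 v0 \<ge> F w - G w 0 = J w\<close>, and \<open>J w \<ge> J u0\<close> for \<open>v1\<close> near \<open>v1_hat\<close> because \<open>u0\<close> is a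
  local minimizer. Conversely \<open>J_star v1_hat v0 \<le> J u0\<close> on all of \<open>C\<close>: for each component, the
  difference is \<open>d\<^sup>2 (2 u0\<^sup>2 / (K - 2 v0) - 1 / (2\<alpha>))\<close> with \<open>d = v0 - v0_hat\<close>, which is nonpositive by
  the bounds on \<open>K\<close>.
\<close>

section \<open>Attained extrema and matrix-vector algebra\<close>

lemma SUP_ereal_attained:
  assumes "\<And>y. h y \<le> h x"
  shows "(SUP y. ereal (h y)) = ereal (h x)"
  by (rule antisym[OF SUP_least SUP_upper]) (auto intro: assms)

lemma INF_ereal_attained:
  assumes "\<And>y. h x \<le> h y"
  shows "(INF y. ereal (h y)) = ereal (h x)"
  by (rule antisym[OF INF_lower INF_greatest]) (auto intro: assms)

lemma diag_mat_mult_vec: "diag_mat d *v x = (\<chi> i. d $ i * x $ i)"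
  by (simp add: diag_mat_def matrix_vector_mult_def vec_eq_iff if_distrib if_distribR cong: if_cong)

lemma inner_diag_mat: "x \<bullet> (diag_mat d *v y) = (\<Sum>i\<in>UNIV. d $ i * x $ i * y $ i)"
  by (simp add: diag_mat_mult_vec inner_vec_def mult_ac)

lemma mat_mult_vec: "mat c *v x = c *\<^sub>R (x :: real ^ 'n)"
  by (simp add: mat_def matrix_vector_mult_def vec_eq_iff if_distrib if_distribR cong: if_cong)

lemma scaleR_mat_mult_vec: "(c *\<^sub>R A) *v x = c *\<^sub>R (A *v (x :: real ^ 'n))"
  by (simp add: matrix_vector_mult_def vec_eq_iff sum_distrib_left mult_ac)

lemma inner_laplacian: "u \<bullet> (laplacian D *v v) = - ((D *v u) \<bullet> (D *v v))"
  by (simp add: laplacian_integration_by_parts)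

lemma matrix_inv_mult_vec:
  fixes A :: "real ^ 'n ^ 'n"
  assumes "invertible A"
  shows "A *v (matrix_inv A *v x) = x" and "matrix_inv A *v (A *v x) = x"
proof -
  have "A ** matrix_inv A = mat 1 \<and> matrix_inv A ** A = mat 1"
    using assms unfolding invertible_def matrix_inv_def by (rule someI_ex)
  then show "A *v (matrix_inv A *v x) = x" "matrix_inv A *v (A *v x) = x"
    by (simp_all add: matrix_vector_mul_assoc)
qed

lemma matrix_inv_diag_mat:
  fixes d :: "real ^ 'n"
  assumes "\<And>i. d $ i \<noteq> 0"
  shows "matrix_inv (diag_mat d) *v x = (\<chi> i. x $ i / d $ i)"
proof -
  have "invertible (diag_mat d)"
    unfolding invertible_left_inverse matrix_left_invertible_ker
    using assms by (simp add: diag_mat_mult_vec vec_eq_iff)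
  then have "matrix_inv (diag_mat d) *v (diag_mat d *v (\<chi> i. x $ i / d $ i)) = (\<chi> i. x $ i / d $ i)"
    by (rule matrix_inv_mult_vec(2))
  moreover have "diag_mat d *v (\<chi> i. x $ i / d $ i) = x"
    using assms by (simp add: diag_mat_mult_vec vec_eq_iff)
  ultimately show ?thesis by simp
qed

section \<open>Quadratic forms, Rayleigh quotients and geometric means\<close>

lemma pos_def_imp_pos_semidef:
  assumes "pos_def A"
  shows "pos_semidef A"
  unfolding pos_semidef_def
proof
  fix x
  show "x \<bullet> (A *v x) \<ge> 0"
    using assms by (cases "x = 0") (simp_all add: pos_def_def less_imp_le)
qed

lemma pos_def_imp_invertible:
  assumes "pos_def A"
  shows "invertible A"
  unfolding invertible_left_inverse matrix_left_invertible_ker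
  using assms unfolding pos_def_def by fastforce

lemma symmetric_matrix_inner:
  assumes "transpose A = (A :: real ^ 'n ^ 'n)"
  shows "x \<bullet> (A *v y) = y \<bullet> (A *v x)"
  by (metis assms dot_lmul_matrix inner_commute transpose_matrix_vector)

lemma quadratic_form_add:
  assumes "transpose A = (A :: real ^ 'n ^ 'n)"
  shows "(x + t *\<^sub>R y) \<bullet> (A *v (x + t *\<^sub>R y))
    = x \<bullet> (A *v x) + 2 * t * (y \<bullet> (A *v x)) + t\<^sup>2 * (y \<bullet> (A *v y))"
  using symmetric_matrix_inner[OF assms, of x y]
  by (simp add: matrix_vector_right_distrib matrix_vector_mult_scaleR inner_add_left
      inner_add_right power2_eq_square algebra_simps)

text \<open>Expand the nonnegative form at \<open>w - u\<close>. The concave function of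
  \<open>u\<close> on the left is thus largest at \<open>u = w\<close>, which evaluates both
  conjugates; the same bound controls the mixed term in the geometric mean argument.\<close>

lemma quadratic_conjugate_le:
  assumes "transpose A = (A :: real ^ 'n ^ 'n)" and "pos_semidef A"
  shows "u \<bullet> (A *v w) - u \<bullet> (A *v u) / 2 \<le> w \<bullet> (A *v w) / 2"
  using assms(2)[unfolded pos_semidef_def, rule_format, of "w + (-1) *\<^sub>R u"]
  unfolding quadratic_form_add[OF assms(1)] by simp

text \<open>The derivative of \<open>t \<mapsto> (x + t y) \<bullet> N (x + t y) \<ge> 0\<close> vanishes at its minimum \<open>t = 0\<close>.\<close>

lemma pos_semidef_isotropic:
  assumes "transpose N = (N :: real ^ 'n ^ 'n)" and "pos_semidef N" and "x \<bullet> (N *v x) = 0"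
  shows "y \<bullet> (N *v x) = 0"
proof -
  have nonneg: "2 * t * (y \<bullet> (N *v x)) + t\<^sup>2 * (y \<bullet> (N *v y)) \<ge> 0" for t
    using assms(2)[unfolded pos_semidef_def, rule_format, of "x + t *\<^sub>R y"]
    unfolding quadratic_form_add[OF assms(1)] using assms(3) by simp
  have deriv: "((\<lambda>t. 2 * t * (y \<bullet> (N *v x)) + t\<^sup>2 * (y \<bullet> (N *v y)))
      has_real_derivative 2 * (y \<bullet> (N *v x))) (at 0)"
    by (rule derivative_eq_intros refl | simp)+
  have "2 * (y \<bullet> (N *v x)) = 0"
    by (rule DERIV_local_min[OF deriv, of 1]) (use nonneg in auto)
  then show ?thesis by simp
qed

text \<open>The quotient of two quadratic forms is constant along rays, so it can be maximized on
  the compact unit sphere, where positive definiteness of \<open>R\<close> makes it continuous. The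
  bound avoids division in order to include \<open>y = 0\<close>.\<close>

lemma generalized_Rayleigh_quotient_attained:
  fixes M R :: "real ^ 'n ^ 'n"
  assumes "pos_def R"
  obtains x c where "x \<noteq> 0" and "x \<bullet> (M *v x) = c * (x \<bullet> (R *v x))"
    and "\<And>y. y \<bullet> (M *v y) \<le> c * (y \<bullet> (R *v y))"
proof -
  define q where "q y = (y \<bullet> (M *v y)) / (y \<bullet> (R *v y))" for y
  have R_pos: "y \<bullet> (R *v y) > 0" if "y \<noteq> 0" for y
    using assms that by (simp add: pos_def_def)
  have "continuous_on (sphere 0 1) q"
    unfolding q_def
    by (intro continuous_intros linear_continuous_on_compose[OF continuous_on_id]
        matrix_vector_mul_linear) (metis R_pos less_irrefl mem_sphere_0 norm_zero zero_neq_one)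
  then obtain x where x: "x \<in> sphere 0 1" and max: "\<And>y. y \<in> sphere 0 1 \<Longrightarrow> q y \<le> q x"
    using continuous_attains_sup[of "sphere 0 1" q] by auto
  have "y \<bullet> (M *v y) \<le> q x * (y \<bullet> (R *v y))" for y
  proof (cases "y = 0")
    case False
    then have "q (y /\<^sub>R norm y) \<le> q x"
      by (intro max) simp
    moreover have "q (y /\<^sub>R norm y) = q y"
      using False by (simp add: q_def matrix_vector_mult_scaleR)
    ultimately show ?thesis
      using R_pos[OF False] by (simp add: q_def pos_divide_le_eq)
  qed simp
  moreover have "x \<noteq> 0"
    using x by auto
  moreover have "x \<bullet> (M *v x) = q x * (x \<bullet> (R *v x))"
    using R_pos[OF \<open>x \<noteq> 0\<close>] by (simp add: q_def)
  ultimately show thesis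
    using that by blast
qed

text \<open>Maximize the Rayleigh quotient of \<open>- A\<close> against the identity: the maximum
  is attained, hence negative, and its negative is the coercivity constant.\<close>

lemma pos_def_coercive:
  assumes "pos_def (A :: real ^ 'n ^ 'n)"
  obtains c where "c > 0" and "\<And>y. c * (y \<bullet> y) \<le> y \<bullet> (A *v y)"
proof -
  have "pos_def (mat 1 :: real ^ 'n ^ 'n)"
    by (simp add: pos_def_def)
  then obtain x c where x: "x \<noteq> 0" "x \<bullet> ((- 1 *\<^sub>R A) *v x) = c * (x \<bullet> (mat 1 *v x))"
    and c: "\<And>y. y \<bullet> ((- 1 *\<^sub>R A) *v y) \<le> c * (y \<bullet> (mat 1 *v y))"
    by (rule generalized_Rayleigh_quotient_attained[where M = "- 1 *\<^sub>R A"]) blast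
  have "x \<bullet> (A *v x) > 0"
    using assms x(1) by (simp add: pos_def_def)
  then have "c * (x \<bullet> x) < 0"
    using x(2) unfolding scaleR_mat_mult_vec by simp
  then have "- c > 0"
    using inner_ge_zero[of x] by (auto simp: mult_less_0_iff)
  moreover have "- c * (y \<bullet> y) \<le> y \<bullet> (A *v y)" for y
    using c[of y] unfolding scaleR_mat_mult_vec by simp
  ultimately show thesis
    using that by blast
qed

text \<open>
  Monotonicity of the matrix geometric mean in the case where the two upper bounds are diagonal.
  A maximizer \<open>x\<close> of the quotient of \<open>M\<close> by \<open>diag r\<close> solves \<open>M x = c diag r x\<close>; testing the
  inequality \<open>2 (y \<bullet> M x) \<le> y \<bullet> M y + x \<bullet> M x\<close> at \<open>y = (diag r / diag a) x\<close> gives \<open>c \<le> 1\<close>.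
\<close>

lemma diagonal_geometric_mean_dominates:
  fixes M :: "real ^ 'n ^ 'n" and a b r :: "real ^ 'n"
  assumes sym: "transpose M = M" and psd: "pos_semidef M"
    and a: "\<And>x. x \<bullet> (M *v x) \<le> x \<bullet> (diag_mat a *v x)"
    and b: "\<And>x. x \<bullet> (M *v x) \<le> x \<bullet> (diag_mat b *v x)"
    and pos: "\<And>i. a $ i > 0" "\<And>i. b $ i > 0" "\<And>i. r $ i > 0"
    and r: "\<And>i. (r $ i)\<^sup>2 = a $ i * b $ i"
  shows "y \<bullet> (M *v y) \<le> y \<bullet> (diag_mat r *v y)"
proof -
  have sum_pos: "y \<bullet> (diag_mat d *v y) > 0" if d: "\<And>i. d $ i > 0" and y: "y \<noteq> 0" for d y :: "real ^ 'n"
  proof -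
    obtain i where "y $ i \<noteq> 0"
      using y by (metis vec_eq_iff zero_index)
    moreover have "d $ j * y $ j * y $ j \<ge> 0" for j
      using d[of j] by (simp add: mult.assoc)
    ultimately show ?thesis
      unfolding inner_diag_mat using d[of i]
      by (intro sum_pos2[where i = i]) (auto simp: mult.assoc zero_less_mult_iff linorder_neq_iff)
  qed
  have "pos_def (diag_mat r)"
    unfolding pos_def_def using sum_pos pos(3) by blast
  then obtain x c where x: "x \<noteq> 0" "x \<bullet> (M *v x) = c * (x \<bullet> (diag_mat r *v x))"
    and c: "\<And>y. y \<bullet> (M *v y) \<le> c * (y \<bullet> (diag_mat r *v y))"
    by (rule generalized_Rayleigh_quotient_attained[where M = M]) blast
  \<comment> \<open>Maximality of \<open>c\<close> makes \<open>N\<close> positive semidefinite with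
    \<open>x\<close> isotropic, so \<open>x\<close> lies in the kernel of \<open>N\<close>; this is
    the generalized eigenvector equation.\<close>
  define N where "N = c *\<^sub>R diag_mat r - M"
  have N: "y \<bullet> (N *v z) = c * (y \<bullet> (diag_mat r *v z)) - y \<bullet> (M *v z)" for y z
    by (simp add: N_def matrix_vector_mult_diff_rdistrib scaleR_mat_mult_vec inner_diff_right)
  have "transpose N = N"
    using sym by (simp add: N_def diag_mat_def transpose_def vec_eq_iff)
  moreover have "pos_semidef N"
    using c by (simp add: pos_semidef_def N)
  moreover have "x \<bullet> (N *v x) = 0"
    using x(2) by (simp add: N)
  ultimately have eigen: "y \<bullet> (M *v x) = c * (y \<bullet> (diag_mat r *v x))" for y
    using pos_semidef_isotropic[of N x y] by (simp add: N)
  \<comment> \<open>Since \<open>r^2 = a * b\<close> componentwise, this rescaling turns both the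
    \<open>diag_mat a\<close> form at \<open>y\<close> and the mixed \<open>diag_mat r\<close> form
    of \<open>y\<close> and \<open>x\<close> into the \<open>diag_mat b\<close> form at
    \<open>x\<close>.\<close>
  define y where "y = (\<chi> i. r $ i / a $ i * x $ i)"
  have "y \<bullet> (diag_mat a *v y) = x \<bullet> (diag_mat b *v x)"
    unfolding inner_diag_mat
  proof (rule sum.cong[OF refl])
    fix i
    have "a $ i * y $ i * y $ i = (r $ i)\<^sup>2 / a $ i * x $ i * x $ i"
      using pos(1)[of i] by (simp add: y_def power2_eq_square)
    then show "a $ i * y $ i * y $ i = b $ i * x $ i * x $ i"
      using pos(1)[of i] by (simp add: r)
  qed
  moreover have "y \<bullet> (diag_mat r *v x) = x \<bullet> (diag_mat b *v x)"
    unfolding inner_diag_mat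
  proof (rule sum.cong[OF refl])
    fix i
    have "r $ i * y $ i * x $ i = (r $ i)\<^sup>2 / a $ i * x $ i * x $ i"
      by (simp add: y_def power2_eq_square)
    then show "r $ i * y $ i * x $ i = b $ i * x $ i * x $ i"
      using pos(1)[of i] by (simp add: r)
  qed
  moreover have "2 * (y \<bullet> (M *v x)) \<le> y \<bullet> (M *v y) + x \<bullet> (M *v x)"
    using quadratic_conjugate_le[OF sym psd, of y x] by simp
  ultimately have "c * (x \<bullet> (diag_mat b *v x)) \<le> x \<bullet> (diag_mat b *v x)"
    using a[of y] b[of x] eigen[of y] by simp
  then have "c \<le> 1"
    using sum_pos[OF pos(2) x(1)] by simp
  moreover have "y \<bullet> (diag_mat r *v y) \<ge> 0" for y
    unfolding inner_diag_mat using less_imp_le[OF pos(3)]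
    by (intro sum_nonneg) (simp add: mult.assoc)
  ultimately show "y \<bullet> (M *v y) \<le> y \<bullet> (diag_mat r *v y)" for y
    using c[of y] mult_right_mono[of c 1 "y \<bullet> (diag_mat r *v y)"] by force
qed

section \<open>The discrete Laplacian and the closed forms of both conjugates\<close>

lemma transpose_laplacian: "transpose (laplacian D) = laplacian D"
proof -
  have "transpose (- A) = - transpose A" for A :: "real ^ 'a ^ 'a"
    by (simp add: transpose_def vec_eq_iff)
  then show ?thesis
    by (simp add: laplacian_def matrix_transpose_mul)
qed

text \<open>The sign of \<open>d\<close> is left free to cover both
  \<open>K - \<gamma> \<nabla>^2\<close> and
  \<open>2 \<alpha> \<beta> + \<gamma> \<nabla>^2\<close>.\<close>

lemma transpose_mat_plus_laplacian:
  "transpose (mat c + d *\<^sub>R laplacian D) = mat c + d *\<^sub>R laplacian D"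
  using transpose_laplacian[of D] by (simp add: transpose_def mat_def vec_eq_iff)

lemma inner_mat_plus_laplacian:
  "x \<bullet> ((mat c + d *\<^sub>R laplacian D) *v y) = c * (x \<bullet> y) - d * ((D *v x) \<bullet> (D *v y))"
  by (simp add: matrix_vector_mult_add_rdistrib scaleR_mat_mult_vec mat_mult_vec inner_add_right
      inner_laplacian)

lemma F_eq_quadratic_form: "F \<gamma> K D u = u \<bullet> ((mat K - \<gamma> *\<^sub>R laplacian D) *v u) / 2"
  using inner_mat_plus_laplacian[of u K "- \<gamma>" D u] by (simp add: F_def field_simps)

lemma pos_def_mat_minus_laplacian:
  assumes "\<gamma> \<ge> 0" and "K > 0"
  shows "pos_def (mat K - \<gamma> *\<^sub>R laplacian D)"
  unfolding pos_def_def
proof (intro allI impI)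
  fix x :: "real ^ 'a"
  assume "x \<noteq> 0"
  then have "K * (x \<bullet> x) > 0"
    using assms by simp
  moreover have "\<gamma> * ((D *v x) \<bullet> (D *v x)) \<ge> 0"
    using assms by simp
  ultimately show "x \<bullet> ((mat K - \<gamma> *\<^sub>R laplacian D) *v x) > 0"
    using inner_mat_plus_laplacian[of x K "- \<gamma>" D x] by simp
qed

text \<open>The point \<open>w\<close> is stationary for the concave objective. A solution of the
  linear system, rather than \<open>matrix_inv\<close>, appears here so that \<open>u0\<close> can
  be inserted directly.\<close>

lemma F_star_attained:
  assumes "\<gamma> \<ge> 0" and "K > 0" and "(mat K - \<gamma> *\<^sub>R laplacian D) *v w = v1"
  shows "F_star \<gamma> K D v1 = ereal (w \<bullet> v1 - F \<gamma> K D w)"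
  unfolding F_star_def
proof (rule SUP_ereal_attained)
  fix u
  let ?A = "mat K - \<gamma> *\<^sub>R laplacian D"
  have "pos_semidef ?A"
    by (intro pos_def_imp_pos_semidef pos_def_mat_minus_laplacian assms(1,2))
  moreover have "transpose ?A = ?A"
    using transpose_mat_plus_laplacian[of K "- \<gamma>" D] by simp
  ultimately have "u \<bullet> (?A *v w) - u \<bullet> (?A *v u) / 2 \<le> w \<bullet> (?A *v w) / 2"
    by (intro quadratic_conjugate_le)
  then show "u \<bullet> v1 - F \<gamma> K D u \<le> w \<bullet> v1 - F \<gamma> K D w"
    unfolding F_eq_quadratic_form assms(3) by simp
qed

lemma F_star_eq:
  assumes "\<gamma> \<ge> 0" and "K > 0"
  shows "F_star \<gamma> K D v1 = ereal (1 / 2 * (v1 \<bullet> (matrix_inv (mat K - \<gamma> *\<^sub>R laplacian D) *v v1)))"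
proof -
  let ?A = "mat K - \<gamma> *\<^sub>R laplacian D"
  have "?A *v (matrix_inv ?A *v v1) = v1"
    by (intro matrix_inv_mult_vec(1) pos_def_imp_invertible pos_def_mat_minus_laplacian assms)
  then show ?thesis
    using F_star_attained[OF assms, of D "matrix_inv ?A *v v1" v1]
    by (simp add: F_eq_quadratic_form inner_commute)
qed

text \<open>Completing the square in \<open>v\<close> confines \<open>v\<close> to the last sum. The
  cross term moves \<open>v0\<close> into the coefficient of \<open>u^2\<close>, which produces the
  diagonal matrix \<open>K - 2 v0\<close>.\<close>

lemma G_complete_square:
  assumes "\<alpha> \<noteq> 0"
  shows "u \<bullet> v1 - v \<bullet> v0 - G \<alpha> \<beta> K f u v =
    u \<bullet> (v1 - f) - u \<bullet> (diag_mat (\<chi> i. K - 2 * v0 $ i) *v u) / 2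
    - (1 / (2 * \<alpha>) * (v0 \<bullet> v0) + \<beta> * (\<Sum>i\<in>UNIV. v0 $ i))
    + \<alpha> / 2 * (\<Sum>i\<in>UNIV. ((u $ i)\<^sup>2 - \<beta> + v $ i - v0 $ i / \<alpha>)\<^sup>2)"
  unfolding inner_diag_mat
  unfolding G_def inner_vec_def sum_distrib_left sum_divide_distrib inner_real_def
    sum.distrib[symmetric] sum_subtractf[symmetric]
  by (rule sum.cong[OF refl]) (use assms in \<open>simp add: field_simps power2_eq_square\<close>)

lemma INF_G:
  assumes "\<alpha> > 0"
  shows "(INF v. ereal (u \<bullet> v1 - v \<bullet> v0 - G \<alpha> \<beta> K f u v)) =
    ereal (u \<bullet> (v1 - f) - u \<bullet> (diag_mat (\<chi> i. K - 2 * v0 $ i) *v u) / 2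
      - (1 / (2 * \<alpha>) * (v0 \<bullet> v0) + \<beta> * (\<Sum>i\<in>UNIV. v0 $ i)))"
proof -
  let ?h = "\<lambda>v. u \<bullet> v1 - v \<bullet> v0 - G \<alpha> \<beta> K f u v"
  \<comment> \<open>This choice makes every square in \<open>G_complete_square\<close>
    vanish.\<close>
  let ?w = "\<chi> i. v0 $ i / \<alpha> + \<beta> - (u $ i)\<^sup>2"
  have "?h ?w \<le> ?h v" for v
    unfolding G_complete_square[OF less_imp_neq[OF assms, symmetric]]
    using assms by (simp add: sum_nonneg)
  then have "(INF v. ereal (?h v)) = ereal (?h ?w)"
    by (rule INF_ereal_attained)
  then show ?thesis
    unfolding G_complete_square[OF less_imp_neq[OF assms, symmetric]] by simp
qed

text \<open>Once the infimum over \<open>v\<close> is evaluated, a concave quadratic in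
  \<open>u\<close> with diagonal matrix remains, maximized by componentwise division. The sum form
  allows comparison one component at a time.\<close>

lemma G_star_sum:
  fixes v0 :: "real ^ 'n"
  assumes "\<alpha> > 0" and pos: "\<And>i. K - 2 * v0 $ i > 0"
  shows "G_star \<alpha> \<beta> K f v1 v0 =
    ereal (\<Sum>i\<in>UNIV. ((v1 - f) $ i)\<^sup>2 / (2 * (K - 2 * v0 $ i)) - (v0 $ i)\<^sup>2 / (2 * \<alpha>) - \<beta> * v0 $ i)"
proof -
  let ?B = "diag_mat (\<chi> i. K - 2 * v0 $ i)"
  let ?w = "\<chi> i. (v1 - f) $ i / (K - 2 * v0 $ i)"
  let ?c = "1 / (2 * \<alpha>) * (v0 \<bullet> v0) + \<beta> * (\<Sum>i\<in>UNIV. v0 $ i)"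
  have w: "?B *v ?w = v1 - f"
    using pos by (simp add: diag_mat_mult_vec vec_eq_iff less_imp_neq[symmetric])
  have "transpose ?B = ?B"
    by (simp add: transpose_def diag_mat_def vec_eq_iff)
  moreover have "pos_semidef ?B"
    unfolding pos_semidef_def inner_diag_mat
    using less_imp_le[OF pos] by (auto intro!: sum_nonneg simp: mult.assoc)
  ultimately have "u \<bullet> (?B *v ?w) - u \<bullet> (?B *v u) / 2 \<le> ?w \<bullet> (?B *v ?w) / 2" for u
    by (rule quadratic_conjugate_le)
  then have "u \<bullet> (v1 - f) - u \<bullet> (?B *v u) / 2 - ?c
      \<le> ?w \<bullet> (v1 - f) - ?w \<bullet> (?B *v ?w) / 2 - ?c" for u
    unfolding w by (simp add: field_simps)
  then have "G_star \<alpha> \<beta> K f v1 v0 = ereal (?w \<bullet> (v1 - f) - ?w \<bullet> (?B *v ?w) / 2 - ?c)"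
    unfolding G_star_def INF_G[OF assms(1)] by (rule SUP_ereal_attained)
  also have "?w \<bullet> (v1 - f) - ?w \<bullet> (?B *v ?w) / 2 - ?c =
      (\<Sum>i\<in>UNIV. ((v1 - f) $ i)\<^sup>2 / (2 * (K - 2 * v0 $ i)) - (v0 $ i)\<^sup>2 / (2 * \<alpha>) - \<beta> * v0 $ i)"
    unfolding w unfolding inner_vec_def sum_distrib_left sum_divide_distrib inner_real_def
      sum.distrib[symmetric] sum_subtractf[symmetric]
  proof (rule sum.cong[OF refl])
    fix i
    have half: "x / z - x / z / 2 = x / (2 * z)" for x z :: real
      by (simp add: divide_simps)
    show "?w $ i * (v1 - f) $ i - ?w $ i * (v1 - f) $ i / 2 -
        (1 / (2 * \<alpha>) * (v0 $ i * v0 $ i) + \<beta> * v0 $ i) =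
        ((v1 - f) $ i)\<^sup>2 / (2 * (K - 2 * v0 $ i)) - (v0 $ i)\<^sup>2 / (2 * \<alpha>) - \<beta> * v0 $ i"
      using half[of "((v1 - f) $ i)\<^sup>2" "K - 2 * v0 $ i"] by (simp add: power2_eq_square)
  qed
  finally show ?thesis .
qed

lemma G_star_eq:
  fixes v0 :: "real ^ 'n"
  assumes "\<alpha> > 0" and pos: "\<And>i. - 2 * v0 $ i + K > 0"
  shows "G_star \<alpha> \<beta> K f v1 v0 =
    ereal (- 1 / 2 * ((v1 - f) \<bullet> (matrix_inv (diag_mat (\<chi> i. 2 * v0 $ i - K)) *v (v1 - f)))
      - 1 / (2 * \<alpha>) * (v0 \<bullet> v0) - \<beta> * (\<Sum>i\<in>UNIV. v0 $ i))"
proof -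
  have pos': "K - 2 * v0 $ i > 0" and neg: "2 * v0 $ i - K < 0" for i
    using pos[of i] by simp_all
  have inv: "matrix_inv (diag_mat (\<chi> i. 2 * v0 $ i - K)) *v (v1 - f)
      = (\<chi> i. (v1 - f) $ i / (2 * v0 $ i - K))"
    using less_imp_neq[OF neg] by (subst matrix_inv_diag_mat) simp_all
  show ?thesis
    unfolding G_star_sum[OF assms(1) pos'] inv inner_vec_def sum_distrib_left sum_divide_distrib
      inner_real_def sum.distrib[symmetric] sum_subtractf[symmetric] ereal.inject
  proof (rule sum.cong[OF refl])
    fix i
    have "x / (2 * (K - 2 * v0 $ i)) = - 1 / 2 * (x / (2 * v0 $ i - K))" for x
      using pos'[of i] neg[of i] by (simp add: field_simps)
    then show "((v1 - f) $ i)\<^sup>2 / (2 * (K - 2 * v0 $ i)) - (v0 $ i)\<^sup>2 / (2 * \<alpha>) - \<beta> * v0 $ i =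
        - 1 / 2 * ((v1 - f) $ i * (\<chi> i. (v1 - f) $ i / (2 * v0 $ i - K)) $ i)
        - 1 / (2 * \<alpha>) * (v0 $ i * v0 $ i) - \<beta> * v0 $ i"
      by (simp add: power2_eq_square)
  qed
qed

section \<open>Expansion of \<open>J\<close> and minimality of the critical point\<close>

lemma J_eq_F_minus_G: "J \<alpha> \<beta> \<gamma> D f u = F \<gamma> K D u - G \<alpha> \<beta> K f u 0"
  by (simp add: J_def F_def G_def)

lemma inner_second_variation_J:
  "x \<bullet> (second_variation (J \<alpha> \<beta> \<gamma> D f) u *v x) =
    x \<bullet> (diag_mat (\<chi> i. 6 * \<alpha> * (u $ i)\<^sup>2) *v x) - x \<bullet> ((mat (2 * \<alpha> * \<beta>) + \<gamma> *\<^sub>R laplacian D) *v x)"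
  unfolding second_variation_J matrix_vector_mult_add_rdistrib matrix_vector_mult_diff_rdistrib
    inner_add_right inner_diff_right scaleR_mat_mult_vec inner_laplacian
  by simp

text \<open>The first variation in direction \<open>h\<close> is the inner product of
  \<open>h\<close> with the residual \<open>?g - f\<close>; testing with the residual itself makes
  it vanish.\<close>

lemma critical_point_eq:
  assumes "\<forall>h. first_variation (J \<alpha> \<beta> \<gamma> D f) u h = 0"
  shows "f = - \<gamma> *\<^sub>R (laplacian D *v u) + (\<chi> i. 2 * \<alpha> * ((u $ i)\<^sup>2 - \<beta>) * u $ i)" (is "f = ?g")
proof -
  have "h \<bullet> (?g - f) = first_variation (J \<alpha> \<beta> \<gamma> D f) u h" for h
    unfolding first_variation_J inner_add_right inner_diff_right inner_scaleR_right inner_laplacian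
      inner_commute[of "D *v u"]
    by (simp add: inner_vec_def[of h "vec_lambda _"] sum_distrib_left mult_ac)
  then have "(?g - f) \<bullet> (?g - f) = 0"
    using assms by simp
  then show ?thesis by simp
qed

text \<open>
  Taylor's formula along the segment from \<open>u\<close> to \<open>u + d\<close>: the integrals of \<open>1 - t\<close> against the
  coefficients of \<open>(u + t d)\<^sup>2 = ((1 - t) u + t (u + d))\<^sup>2\<close> are \<open>1/4\<close>, \<open>1/6\<close>, \<open>1/12\<close>.
\<close>

lemma J_Taylor:
  fixes D :: "real ^ 'n ^ 'm"
  shows "J \<alpha> \<beta> \<gamma> D f (u + d) = J \<alpha> \<beta> \<gamma> D f u + first_variation (J \<alpha> \<beta> \<gamma> D f) u d
    + (\<Sum>i\<in>UNIV. 6 * \<alpha> * ((u $ i)\<^sup>2 / 4 + u $ i * (u + d) $ i / 6 + ((u + d) $ i)\<^sup>2 / 12) * (d $ i)\<^sup>2)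
    - d \<bullet> ((mat (2 * \<alpha> * \<beta>) + \<gamma> *\<^sub>R laplacian D) *v d) / 2"
proof -
  have D: "(D *v (u + d)) \<bullet> (D *v (u + d)) =
      (D *v u) \<bullet> (D *v u) + 2 * ((D *v u) \<bullet> (D *v d)) + (D *v d) \<bullet> (D *v d)"
    by (simp add: matrix_vector_right_distrib inner_add_left inner_add_right inner_commute)
  have "\<alpha> / 2 * (\<Sum>i\<in>UNIV. (((u + d) $ i)\<^sup>2 - \<beta>)\<^sup>2) =
      \<alpha> / 2 * (\<Sum>i\<in>UNIV. ((u $ i)\<^sup>2 - \<beta>)\<^sup>2) + 2 * \<alpha> * (\<Sum>i\<in>UNIV. ((u $ i)\<^sup>2 - \<beta>) * u $ i * d $ i)
      + (\<Sum>i\<in>UNIV. 6 * \<alpha> * ((u $ i)\<^sup>2 / 4 + u $ i * (u + d) $ i / 6 + ((u + d) $ i)\<^sup>2 / 12) * (d $ i)\<^sup>2)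
      - \<alpha> * \<beta> * (d \<bullet> d)"
    unfolding inner_vec_def sum_distrib_left inner_real_def sum.distrib[symmetric]
      sum_subtractf[symmetric]
    by (rule sum.cong[OF refl]) (simp add: field_simps power2_eq_square)
  then show ?thesis
    unfolding J_def[of _ _ _ _ _ "u + d"] D inner_mat_plus_laplacian first_variation_J
    by (simp add: J_def inner_add_left field_simps)
qed

lemma critical_point_le_on_E:
  fixes D :: "real ^ 'n ^ 'm"
  assumes "\<alpha> > 0"
    and neg: "neg_def (- \<gamma> *\<^sub>R laplacian D - mat (2 * \<alpha> * \<beta>))"
    and crit: "\<forall>h. first_variation (J \<alpha> \<beta> \<gamma> D f) u0 h = 0"
    and u0: "u0 \<in> B_plus \<alpha> \<beta> \<gamma> D f"
    and u: "u \<in> A_plus u0" "u \<in> B_plus \<alpha> \<beta> \<gamma> D f"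
  shows "J \<alpha> \<beta> \<gamma> D f u0 \<le> J \<alpha> \<beta> \<gamma> D f u"
proof -
  define M where "M = mat (2 * \<alpha> * \<beta>) + \<gamma> *\<^sub>R laplacian D"
  have M_pos: "x \<bullet> (M *v x) > 0" if "x \<noteq> 0" for x
  proof -
    have "- \<gamma> *\<^sub>R laplacian D - mat (2 * \<alpha> * \<beta>) = (- 1) *\<^sub>R M"
      by (simp add: M_def)
    then show ?thesis
      using neg that unfolding neg_def_def by (metis scaleR_mat_mult_vec inner_scaleR_right
          mult_minus1 neg_less_0_iff_less)
  qed
  then have M_psd: "pos_semidef M"
    by (simp add: pos_def_def pos_def_imp_pos_semidef)
  let ?d = "\<lambda>w. \<chi> i. 6 * \<alpha> * (w $ i)\<^sup>2"
  have dom: "x \<bullet> (M *v x) \<le> x \<bullet> (diag_mat (?d w) *v x)" if "w \<in> B_plus \<alpha> \<beta> \<gamma> D f" for w x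
    using that unfolding B_plus_def pos_semidef_def inner_second_variation_J M_def by simp
  \<comment> \<open>\<open>M\<close> has positive diagonal entries, so domination by
    \<open>diag_mat (?d w)\<close>, tested on unit vectors, excludes zero components.\<close>
  have nonzero: "w $ i \<noteq> 0" if "w \<in> B_plus \<alpha> \<beta> \<gamma> D f" for w i
  proof -
    have "0 < axis i 1 \<bullet> (M *v axis i 1)"
      by (rule M_pos) (simp add: axis_eq_0_iff)
    also have "\<dots> \<le> axis i 1 \<bullet> (diag_mat (?d w) *v axis i 1)"
      by (rule dom[OF that])
    finally show ?thesis
      by (auto simp: inner_axis' diag_mat_mult_vec)
  qed
  have u0_u: "u0 $ i * u $ i > 0" for i
    using u(1) nonzero[OF u0, of i] nonzero[OF u(2), of i]
    by (simp add: A_plus_def mult.commute order_less_le)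
  \<comment> \<open>As \<open>u0\<close> and \<open>u\<close> agree in sign, this is the positive
    componentwise geometric mean of \<open>?d u0\<close> and \<open>?d u\<close>.\<close>
  let ?r = "\<chi> i. 6 * \<alpha> * (u0 $ i * u $ i)"
  define d where "d = u - u0"
  have mean: "d \<bullet> (M *v d) \<le> d \<bullet> (diag_mat ?r *v d)"
    by (rule diagonal_geometric_mean_dominates[OF _ M_psd dom[OF u0] dom[OF u(2)]])
      (use assms(1) nonzero[OF u0] nonzero[OF u(2)] u0_u in
        \<open>simp_all add: M_def transpose_mat_plus_laplacian power_mult_distrib power2_eq_square[of \<alpha>]\<close>)
  have "(\<Sum>i\<in>UNIV. 6 * \<alpha> * ((u0 $ i)\<^sup>2 / 4 + u0 $ i * u $ i / 6 + (u $ i)\<^sup>2 / 12) * (d $ i)\<^sup>2)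
      = d \<bullet> (diag_mat (?d u0) *v d) / 4 + d \<bullet> (diag_mat ?r *v d) / 6 + d \<bullet> (diag_mat (?d u) *v d) / 12"
    unfolding inner_diag_mat sum_divide_distrib sum.distrib[symmetric]
    by (rule sum.cong[OF refl]) (simp add: field_simps power2_eq_square)
  then have "J \<alpha> \<beta> \<gamma> D f u = J \<alpha> \<beta> \<gamma> D f u0 + (d \<bullet> (diag_mat (?d u0) *v d) / 4
      + d \<bullet> (diag_mat ?r *v d) / 6 + d \<bullet> (diag_mat (?d u) *v d) / 12 - d \<bullet> (M *v d) / 2)"
    using J_Taylor[of \<alpha> \<beta> \<gamma> D f u0 d] crit by (simp add: d_def M_def)
  \<comment> \<open>The weights 1/4, 1/6 and 1/12 add up to 1/2, so the three dominations exactly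
    absorb \<open>d \<bullet> (M *v d) / 2\<close>.\<close>
  then show ?thesis
    using dom[OF u0, of d] dom[OF u(2), of d] mean by simp
qed

text \<open>With \<open>d = u - u0\<close>, the Taylor remainder exceeds half the second variation
  at \<open>u0\<close> by \<open>\<alpha> * (2 * u0 * d + d^2 / 2) * d^2\<close> in each component;
  coercivity absorbs this for small \<open>d\<close>.\<close>

lemma critical_point_local_min:
  fixes D :: "real ^ 'n ^ 'm"
  assumes "\<alpha> > 0"
    and crit: "\<forall>h. first_variation (J \<alpha> \<beta> \<gamma> D f) u0 h = 0"
    and pd: "pos_def (second_variation (J \<alpha> \<beta> \<gamma> D f) u0)"
  shows "\<forall>\<^sub>F u in nhds u0. J \<alpha> \<beta> \<gamma> D f u0 \<le> J \<alpha> \<beta> \<gamma> D f u"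
proof -
  obtain c where c: "c > 0" "\<And>y. c * (y \<bullet> y) \<le> y \<bullet> (second_variation (J \<alpha> \<beta> \<gamma> D f) u0 *v y)"
    using pos_def_coercive[OF pd] by blast
  \<comment> \<open>The threshold yields \<open>2 * \<alpha> * norm u0 * norm d < c / 2\<close>,
    which controls the cubic term; the quartic term is nonnegative.\<close>
  have "J \<alpha> \<beta> \<gamma> D f u0 \<le> J \<alpha> \<beta> \<gamma> D f u" if u: "4 * \<alpha> * norm u0 * norm (u - u0) < c" for u
  proof -
    define d where "d = u - u0"
    have nonneg: "0 \<le> (c / 2 + \<alpha> * (2 * u0 $ i * d $ i + (d $ i)\<^sup>2 / 2)) * (d $ i)\<^sup>2" for i
    proof (rule mult_nonneg_nonneg)
      have "\<bar>u0 $ i * d $ i\<bar> \<le> norm u0 * norm d"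
        unfolding abs_mult by (intro mult_mono component_le_norm_cart) simp_all
      then have "- (norm u0 * norm d) \<le> u0 $ i * d $ i + (d $ i)\<^sup>2 / 4"
        by (smt (verit) zero_le_power2 divide_nonneg_nonneg)
      from mult_left_mono[OF this, of "2 * \<alpha>"]
      show "0 \<le> c / 2 + \<alpha> * (2 * u0 $ i * d $ i + (d $ i)\<^sup>2 / 2)"
        using assms(1) u by (simp add: d_def algebra_simps)
    qed simp
    have "0 \<le> (\<Sum>i\<in>UNIV. (c / 2 + \<alpha> * (2 * u0 $ i * d $ i + (d $ i)\<^sup>2 / 2)) * (d $ i)\<^sup>2)"
      by (intro sum_nonneg nonneg)
    also have "\<dots> = c * (d \<bullet> d) / 2
        + (\<Sum>i\<in>UNIV. 6 * \<alpha> * ((u0 $ i)\<^sup>2 / 4 + u0 $ i * u $ i / 6 + (u $ i)\<^sup>2 / 12) * (d $ i)\<^sup>2)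
        - d \<bullet> (diag_mat (\<chi> i. 6 * \<alpha> * (u0 $ i)\<^sup>2) *v d) / 2"
      unfolding inner_diag_mat
      unfolding inner_vec_def sum_distrib_left sum_divide_distrib inner_real_def
        sum.distrib[symmetric] sum_subtractf[symmetric]
      by (rule sum.cong[OF refl]) (simp add: d_def field_simps power2_eq_square)
    finally show ?thesis
      using J_Taylor[of \<alpha> \<beta> \<gamma> D f u0 d] crit c(2)[of d]
      unfolding inner_second_variation_J by (simp add: d_def)
  qed
  moreover have "\<forall>\<^sub>F u in nhds u0. 4 * \<alpha> * norm u0 * norm (u - u0) < c"
  proof (rule order_tendstoD(2)[OF _ c(1)])
    show "((\<lambda>u. 4 * \<alpha> * norm u0 * norm (u - u0)) \<longlongrightarrow> 0) (nhds u0)"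
      by (rule tendsto_eq_intros filterlim_ident refl | simp)+
  qed
  ultimately show ?thesis
    by (auto elim: eventually_mono)
qed

section \<open>Bounds on the dual functional\<close>

text \<open>Choose \<open>u = w\<close> in the supremum defining \<open>G_star\<close>; the infimum over \<open>v\<close> is then attained at \<open>0\<close>.\<close>

lemma J_le_J_star:
  fixes D :: "real ^ 'n ^ 'm"
  assumes "\<alpha> > 0" and "\<gamma> \<ge> 0" and "K > 0" and w: "(mat K - \<gamma> *\<^sub>R laplacian D) *v w = v1"
  shows "ereal (J \<alpha> \<beta> \<gamma> D f w) \<le> J_star \<alpha> \<beta> \<gamma> K D f v1 (\<chi> i. \<alpha> * ((w $ i)\<^sup>2 - \<beta>))"
proof -
  let ?v0 = "\<chi> i. \<alpha> * ((w $ i)\<^sup>2 - \<beta>)"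
  have "w \<bullet> v1 - G \<alpha> \<beta> K f w 0 \<le> w \<bullet> v1 - v \<bullet> ?v0 - G \<alpha> \<beta> K f w v" for v
    using G_complete_square[of \<alpha> w v1 0 ?v0 \<beta> K f] G_complete_square[of \<alpha> w v1 v ?v0 \<beta> K f] assms(1)
    by (simp add: sum_nonneg)
  then have "ereal (w \<bullet> v1 - G \<alpha> \<beta> K f w 0) \<le> G_star \<alpha> \<beta> K f v1 ?v0"
    unfolding G_star_def by (intro SUP_upper2[of w] INF_greatest) simp_all
  then have "ereal (- (w \<bullet> v1 - F \<gamma> K D w)) + ereal (w \<bullet> v1 - G \<alpha> \<beta> K f w 0)
      \<le> J_star \<alpha> \<beta> \<gamma> K D f v1 ?v0"
    unfolding J_star_def F_star_attained[OF assms(2-4)] by (intro add_mono) simp_all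
  then show ?thesis
    by (simp add: J_eq_F_minus_G[of _ _ _ _ _ _ K])
qed

text \<open>Here \<open>p\<close> and \<open>v\<close> are components of \<open>u0\<close> and
  \<open>v0\<close>. Both sides agree at \<open>v = \<alpha> * (p^2 - \<beta>)\<close>, and their
  difference is a square times a factor whose sign follows from
  \<open>4 * \<alpha> * p^2 \<le> K / 2 < K - 2 * v\<close>.\<close>

lemma dual_component_le:
  fixes \<alpha> \<beta> K p v :: real
  assumes "\<alpha> > 0" and "K - 2 * v > K / 2" and "K > 0" and "8 * \<alpha> * p\<^sup>2 \<le> K"
  shows "((K - 2 * (\<alpha> * (p\<^sup>2 - \<beta>))) * p)\<^sup>2 / (2 * (K - 2 * v)) - v\<^sup>2 / (2 * \<alpha>) - \<beta> * v
    \<le> (K - 2 * (\<alpha> * (p\<^sup>2 - \<beta>))) * p\<^sup>2 + \<alpha> / 2 * (p\<^sup>2 - \<beta>)\<^sup>2 - K / 2 * p\<^sup>2" (is "?l \<le> ?r")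
proof -
  define s d where "s = K - 2 * v" and "d = v - \<alpha> * (p\<^sup>2 - \<beta>)"
  have s: "s > 0" "4 * \<alpha> * p\<^sup>2 \<le> s"
    using assms by (simp_all add: s_def)
  have v: "v = \<alpha> * (p\<^sup>2 - \<beta>) + d" and K: "K = s + 2 * (\<alpha> * (p\<^sup>2 - \<beta>) + d)"
    by (simp_all add: s_def d_def)
  have "?l - ?r = d\<^sup>2 * (2 * p\<^sup>2 / s - 1 / (2 * \<alpha>))"
    unfolding s_def[symmetric] unfolding K unfolding v
    using s(1) assms(1) by (simp add: field_simps power2_eq_square)
  also have "\<dots> \<le> 0"
    using s assms(1) by (intro mult_nonneg_nonpos) (simp_all add: field_simps)
  finally show ?thesis by simp
qed

text \<open>At this dual point \<open>F_star\<close> is attained at \<open>u0\<close>, and the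
  critical point equation replaces \<open>v1 - f\<close> by a multiple of \<open>u0\<close> in each
  component, so the claim splits into scalar inequalities.\<close>

lemma J_star_le_J:
  fixes D :: "real ^ 'n ^ 'm"
  assumes "\<alpha> > 0" and "\<gamma> \<ge> 0" and "K > 0" and "\<And>i. 8 * \<alpha> * (u0 $ i)\<^sup>2 \<le> K"
    and crit: "\<forall>h. first_variation (J \<alpha> \<beta> \<gamma> D f) u0 h = 0"
    and "v0 \<in> C K"
  shows "J_star \<alpha> \<beta> \<gamma> K D f (- \<gamma> *\<^sub>R (laplacian D *v u0) + K *\<^sub>R u0) v0 \<le> ereal (J \<alpha> \<beta> \<gamma> D f u0)"
proof -
  define v1 where "v1 = - \<gamma> *\<^sub>R (laplacian D *v u0) + K *\<^sub>R u0"
  have v0: "K - 2 * v0 $ i > K / 2" for i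
    using assms(6) by (simp add: C_def)
  then have v0_pos: "K - 2 * v0 $ i > 0" for i
    using assms(3) by (meson half_gt_zero order_less_trans)
  have v1: "(v1 - f) $ i = (K - 2 * (\<alpha> * ((u0 $ i)\<^sup>2 - \<beta>))) * u0 $ i" for i
    by (subst critical_point_eq[OF crit]) (simp add: v1_def algebra_simps)
  have "(mat K - \<gamma> *\<^sub>R laplacian D) *v u0 = v1"
    by (simp add: v1_def matrix_vector_mult_diff_rdistrib scaleR_mat_mult_vec mat_mult_vec)
  then have F: "F_star \<gamma> K D v1 = ereal (u0 \<bullet> v1 - F \<gamma> K D u0)"
    by (rule F_star_attained[OF assms(2,3)])
  have "(\<Sum>i\<in>UNIV. ((v1 - f) $ i)\<^sup>2 / (2 * (K - 2 * v0 $ i)) - (v0 $ i)\<^sup>2 / (2 * \<alpha>) - \<beta> * v0 $ i)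
      \<le> (\<Sum>i\<in>UNIV. (K - 2 * (\<alpha> * ((u0 $ i)\<^sup>2 - \<beta>))) * (u0 $ i)\<^sup>2
        + \<alpha> / 2 * ((u0 $ i)\<^sup>2 - \<beta>)\<^sup>2 - K / 2 * (u0 $ i)\<^sup>2)"
    unfolding v1 by (intro sum_mono dual_component_le assms v0)
  also have "\<dots> = u0 \<bullet> (v1 - f) + \<alpha> / 2 * (\<Sum>i\<in>UNIV. ((u0 $ i)\<^sup>2 - \<beta>)\<^sup>2) - K / 2 * (u0 \<bullet> u0)"
    unfolding inner_vec_def v1 sum_distrib_left inner_real_def sum.distrib[symmetric]
      sum_subtractf[symmetric]
    by (rule sum.cong[OF refl]) (simp add: power2_eq_square)
  also have "\<dots> = u0 \<bullet> v1 - G \<alpha> \<beta> K f u0 0"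
    by (simp add: G_def inner_diff_right)
  finally have "G_star \<alpha> \<beta> K f v1 v0 \<le> ereal (u0 \<bullet> v1 - G \<alpha> \<beta> K f u0 0)"
    unfolding G_star_sum[OF assms(1) v0_pos] by simp
  then have "J_star \<alpha> \<beta> \<gamma> K D f v1 v0
      \<le> ereal (- (u0 \<bullet> v1 - F \<gamma> K D u0)) + ereal (u0 \<bullet> v1 - G \<alpha> \<beta> K f u0 0)"
    unfolding J_star_def F by (intro add_mono) simp_all
  then show ?thesis
    by (simp add: J_eq_F_minus_G[of _ _ _ _ _ _ K] v1_def)
qed

text \<open>Membership in \<open>C K\<close> amounts to finitely many strict inequalities, each
  continuous in \<open>w\<close>.\<close>

lemma eventually_dual_point_in_C:
  fixes u0 :: "real ^ 'n"
  assumes "(\<chi> i. \<alpha> * ((u0 $ i)\<^sup>2 - \<beta>)) \<in> C K"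
  shows "\<forall>\<^sub>F w in nhds u0. (\<chi> i. \<alpha> * ((w $ i)\<^sup>2 - \<beta>)) \<in> C K"
proof -
  have "\<forall>\<^sub>F w in nhds u0. - 2 * (\<alpha> * ((w $ i)\<^sup>2 - \<beta>)) + K > K / 2" for i
  proof (rule order_tendstoD(1))
    show "((\<lambda>w. - 2 * (\<alpha> * ((w $ i)\<^sup>2 - \<beta>)) + K) \<longlongrightarrow> - 2 * (\<alpha> * ((u0 $ i)\<^sup>2 - \<beta>)) + K) (nhds u0)"
      by (intro tendsto_intros filterlim_ident)
    show "- 2 * (\<alpha> * ((u0 $ i)\<^sup>2 - \<beta>)) + K > K / 2"
      using assms by (simp add: C_def)
  qed
  then show ?thesis
    by (simp add: C_def eventually_all_finite)
qed

text \<open>The continuous map \<open>v1 \<mapsto> matrix_inv A *v v1\<close> sends the dual point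
  to \<open>u0\<close>, so properties near \<open>u0\<close> pull back to nearby \<open>v1\<close>.
  There \<open>\<alpha> * (w^2 - \<beta>)\<close> is an admissible competitor in the
  supremum.\<close>

lemma eventually_J_le_J1_star:
  fixes D :: "real ^ 'n ^ 'm"
  assumes "\<alpha> > 0" and "\<gamma> \<ge> 0" and "K > 0"
    and crit: "\<forall>h. first_variation (J \<alpha> \<beta> \<gamma> D f) u0 h = 0"
    and pd: "pos_def (second_variation (J \<alpha> \<beta> \<gamma> D f) u0)"
    and C: "(\<chi> i. \<alpha> * ((u0 $ i)\<^sup>2 - \<beta>)) \<in> C K"
  shows "\<forall>\<^sub>F v1 in nhds (- \<gamma> *\<^sub>R (laplacian D *v u0) + K *\<^sub>R u0).
    ereal (J \<alpha> \<beta> \<gamma> D f u0) \<le> J1_star \<alpha> \<beta> \<gamma> K D f v1"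
proof -
  define v1_hat where "v1_hat = - \<gamma> *\<^sub>R (laplacian D *v u0) + K *\<^sub>R u0"
  define A where "A = mat K - \<gamma> *\<^sub>R laplacian D"
  have inv: "invertible A"
    unfolding A_def by (intro pos_def_imp_invertible pos_def_mat_minus_laplacian assms)
  have "A *v u0 = v1_hat"
    by (simp add: A_def v1_hat_def matrix_vector_mult_diff_rdistrib scaleR_mat_mult_vec mat_mult_vec)
  then have "matrix_inv A *v v1_hat = u0"
    using matrix_inv_mult_vec(2)[OF inv] by blast
  moreover have "((\<lambda>v1. matrix_inv A *v v1) \<longlongrightarrow> matrix_inv A *v v1_hat) (nhds v1_hat)"
    using matrix_vector_mult_linear_continuous_at[of v1_hat "matrix_inv A"]
    by (simp add: continuous_at_imp_continuous_at_within isCont_def tendsto_nhds_iff)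
  ultimately have lim: "filterlim (\<lambda>v1. matrix_inv A *v v1) (nhds u0) (nhds v1_hat)"
    by simp
  have "\<forall>\<^sub>F w in nhds u0. J \<alpha> \<beta> \<gamma> D f u0 \<le> J \<alpha> \<beta> \<gamma> D f w \<and> (\<chi> i. \<alpha> * ((w $ i)\<^sup>2 - \<beta>)) \<in> C K"
    by (intro eventually_conj critical_point_local_min eventually_dual_point_in_C assms)
  from eventually_compose_filterlim[OF this lim]
  have "\<forall>\<^sub>F v1 in nhds v1_hat. ereal (J \<alpha> \<beta> \<gamma> D f u0) \<le> J1_star \<alpha> \<beta> \<gamma> K D f v1"
  proof (rule eventually_mono)
    fix v1
    define w where "w = matrix_inv A *v v1"
    assume "J \<alpha> \<beta> \<gamma> D f u0 \<le> J \<alpha> \<beta> \<gamma> D f (matrix_inv A *v v1)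
      \<and> (\<chi> i. \<alpha> * (((matrix_inv A *v v1) $ i)\<^sup>2 - \<beta>)) \<in> C K"
    then have w: "J \<alpha> \<beta> \<gamma> D f u0 \<le> J \<alpha> \<beta> \<gamma> D f w" "(\<chi> i. \<alpha> * ((w $ i)\<^sup>2 - \<beta>)) \<in> C K"
      by (simp_all add: w_def)
    have "ereal (J \<alpha> \<beta> \<gamma> D f u0) \<le> ereal (J \<alpha> \<beta> \<gamma> D f w)"
      using w(1) by simp
    also have "\<dots> \<le> J_star \<alpha> \<beta> \<gamma> K D f v1 (\<chi> i. \<alpha> * ((w $ i)\<^sup>2 - \<beta>))"
      using matrix_inv_mult_vec(1)[OF inv] by (intro J_le_J_star assms) (simp add: w_def A_def)
    also have "\<dots> \<le> J1_star \<alpha> \<beta> \<gamma> K D f v1"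
      unfolding J1_star_def by (rule SUP_upper[OF w(2)])
    finally show "ereal (J \<alpha> \<beta> \<gamma> D f u0) \<le> J1_star \<alpha> \<beta> \<gamma> K D f v1" .
  qed
  then show ?thesis
    by (simp add: v1_hat_def)
qed

section \<open>Primal and dual values at the critical point\<close>

theorem theorem6p1:
  fixes \<alpha> \<beta> \<gamma> K K2 :: real
    and D :: "real ^ 'n ^ 'm"
    and f u0 v0_hat v1_hat :: "real ^ 'n"
    and E :: "(real ^ 'n) set"
  assumes "\<alpha> > 0" and "\<beta> > 0" and "\<gamma> > 0"
    and zero_boundary: "inj ((*v) D)"
    and "neg_def (- \<gamma> *\<^sub>R laplacian D - mat (2 * \<alpha> * \<beta>))"
    and "K > 0" and "K2 > 0" and "1 / \<alpha> > 8 * K2\<^sup>2 / K"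
    and "\<forall>h. first_variation (J \<alpha> \<beta> \<gamma> D f) u0 h = 0"
    and "infnorm u0 \<le> K2"
    and "pos_def (second_variation (J \<alpha> \<beta> \<gamma> D f) u0)"
  defines "E \<equiv> A_plus u0 \<inter> B_plus \<alpha> \<beta> \<gamma> D f"
    and "v0_hat \<equiv> \<chi> i. \<alpha> * ((u0 $ i)\<^sup>2 - \<beta>)"
    and "v1_hat \<equiv> - \<gamma> *\<^sub>R (laplacian D *v u0) + K *\<^sub>R u0"
  assumes "v0_hat \<in> C K"
  shows "(\<forall>u. J \<alpha> \<beta> \<gamma> D f u = F \<gamma> K D u - G \<alpha> \<beta> K f u 0) \<and>
         (\<forall>v1. F_star \<gamma> K D v1 =
           ereal (1 / 2 * (v1 \<bullet> (matrix_inv (mat K - \<gamma> *\<^sub>R laplacian D) *v v1)))) \<and>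
         (\<forall>v1 v0. (\<forall>i. - 2 * v0 $ i + K > 0) \<longrightarrow>
           G_star \<alpha> \<beta> K f v1 v0 =
           ereal (- 1 / 2 * ((v1 - f) \<bullet> (matrix_inv (diag_mat (\<chi> i. 2 * v0 $ i - K)) *v (v1 - f)))
                  - 1 / (2 * \<alpha>) * (v0 \<bullet> v0) - \<beta> * (\<Sum>i\<in>UNIV. v0 $ i))) \<and>
         (\<exists>r>0.
           ereal (J \<alpha> \<beta> \<gamma> D f u0) = (INF u \<in> E. ereal (J \<alpha> \<beta> \<gamma> D f u)) \<and>
           (INF u \<in> E. ereal (J \<alpha> \<beta> \<gamma> D f u)) = (INF v1 \<in> ball v1_hat r. J1_star \<alpha> \<beta> \<gamma> K D f v1) \<and>
           (INF v1 \<in> ball v1_hat r. J1_star \<alpha> \<beta> \<gamma> K D f v1) = J1_star \<alpha> \<beta> \<gamma> K D f v1_hat \<and>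
           J1_star \<alpha> \<beta> \<gamma> K D f v1_hat =
             (INF v1 \<in> ball v1_hat r. SUP v0 \<in> C K. J_star \<alpha> \<beta> \<gamma> K D f v1 v0) \<and>
           (INF v1 \<in> ball v1_hat r. SUP v0 \<in> C K. J_star \<alpha> \<beta> \<gamma> K D f v1 v0) =
             J_star \<alpha> \<beta> \<gamma> K D f v1_hat v0_hat)"
proof -
  have \<gamma>: "\<gamma> \<ge> 0"
    using \<open>\<gamma> > 0\<close> by simp
  have B_u0: "u0 \<in> B_plus \<alpha> \<beta> \<gamma> D f"
    using \<open>pos_def (second_variation (J \<alpha> \<beta> \<gamma> D f) u0)\<close>
    by (simp add: B_plus_def pos_def_imp_pos_semidef)
  then have "u0 \<in> E"
    by (simp add: E_def A_plus_def)
  have J_E: "(INF u \<in> E. ereal (J \<alpha> \<beta> \<gamma> D f u)) = ereal (J \<alpha> \<beta> \<gamma> D f u0)"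
  proof (rule antisym[OF INF_lower[OF \<open>u0 \<in> E\<close>] INF_greatest])
    fix u
    assume "u \<in> E"
    then show "ereal (J \<alpha> \<beta> \<gamma> D f u0) \<le> ereal (J \<alpha> \<beta> \<gamma> D f u)"
      using critical_point_le_on_E[OF assms(1,5,9) B_u0] by (simp add: E_def)
  qed
  have bound: "8 * \<alpha> * (u0 $ i)\<^sup>2 \<le> K" for i
  proof -
    have "\<bar>u0 $ i\<bar> \<le> \<bar>K2\<bar>"
      using component_le_infnorm_cart[of u0 i] \<open>infnorm u0 \<le> K2\<close> by simp
    then have "8 * \<alpha> * (u0 $ i)\<^sup>2 \<le> 8 * \<alpha> * K2\<^sup>2"
      using \<open>\<alpha> > 0\<close> by (simp add: abs_le_square_iff)
    also have "\<dots> \<le> K"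
      using \<open>1 / \<alpha> > 8 * K2\<^sup>2 / K\<close> \<open>\<alpha> > 0\<close> \<open>K > 0\<close> by (simp add: field_simps)
    finally show ?thesis .
  qed
  have "(mat K - \<gamma> *\<^sub>R laplacian D) *v u0 = v1_hat"
    by (simp add: v1_hat_def matrix_vector_mult_diff_rdistrib scaleR_mat_mult_vec mat_mult_vec)
  \<comment> \<open>Three inequalities close a cycle through \<open>J\<close>, \<open>J_star\<close>
    and \<open>J1_star\<close>, forcing equality of all values at the critical pair.\<close>
  then have "ereal (J \<alpha> \<beta> \<gamma> D f u0) \<le> J_star \<alpha> \<beta> \<gamma> K D f v1_hat v0_hat"
    unfolding v0_hat_def by (rule J_le_J_star[OF \<open>\<alpha> > 0\<close> \<gamma> \<open>K > 0\<close>])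
  moreover have "J_star \<alpha> \<beta> \<gamma> K D f v1_hat v0_hat \<le> J1_star \<alpha> \<beta> \<gamma> K D f v1_hat"
    unfolding J1_star_def by (rule SUP_upper[OF \<open>v0_hat \<in> C K\<close>])
  moreover have "J1_star \<alpha> \<beta> \<gamma> K D f v1_hat \<le> ereal (J \<alpha> \<beta> \<gamma> D f u0)"
    unfolding J1_star_def v1_hat_def
    by (intro SUP_least J_star_le_J \<gamma> bound assms(1,6,9))
  ultimately have J_star_hat: "J_star \<alpha> \<beta> \<gamma> K D f v1_hat v0_hat = ereal (J \<alpha> \<beta> \<gamma> D f u0)"
    and J1_star_hat: "J1_star \<alpha> \<beta> \<gamma> K D f v1_hat = ereal (J \<alpha> \<beta> \<gamma> D f u0)"
    by simp_all
  obtain r where "r > 0" and r: "\<And>v1. v1 \<in> ball v1_hat r \<Longrightarrow>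
      ereal (J \<alpha> \<beta> \<gamma> D f u0) \<le> J1_star \<alpha> \<beta> \<gamma> K D f v1"
    using eventually_J_le_J1_star[OF \<open>\<alpha> > 0\<close> \<gamma> \<open>K > 0\<close> assms(9,11)
        \<open>v0_hat \<in> C K\<close>[unfolded v0_hat_def]]
    unfolding v1_hat_def[symmetric] eventually_nhds_metric by (auto simp: dist_commute)
  \<comment> \<open>The lower bound valid on the whole ball is attained at its center.\<close>
  have inf_ball: "(INF v1 \<in> ball v1_hat r. J1_star \<alpha> \<beta> \<gamma> K D f v1) = ereal (J \<alpha> \<beta> \<gamma> D f u0)"
  proof (rule antisym[OF _ INF_greatest[OF r]])
    show "(INF v1 \<in> ball v1_hat r. J1_star \<alpha> \<beta> \<gamma> K D f v1) \<le> ereal (J \<alpha> \<beta> \<gamma> D f u0)"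
      using INF_lower[of v1_hat "ball v1_hat r" "J1_star \<alpha> \<beta> \<gamma> K D f"] \<open>r > 0\<close>
      by (simp add: J1_star_hat)
  qed
  show ?thesis
  proof (intro conjI exI[of _ r])
    show "\<forall>u. J \<alpha> \<beta> \<gamma> D f u = F \<gamma> K D u - G \<alpha> \<beta> K f u 0"
      by (simp add: J_eq_F_minus_G)
    show "\<forall>v1. F_star \<gamma> K D v1 =
        ereal (1 / 2 * (v1 \<bullet> (matrix_inv (mat K - \<gamma> *\<^sub>R laplacian D) *v v1)))"
      using F_star_eq[OF \<gamma> \<open>K > 0\<close>] by blast
    show "\<forall>v1 v0. (\<forall>i. - 2 * v0 $ i + K > 0) \<longrightarrow>
        G_star \<alpha> \<beta> K f v1 v0 =
        ereal (- 1 / 2 * ((v1 - f) \<bullet> (matrix_inv (diag_mat (\<chi> i. 2 * v0 $ i - K)) *v (v1 - f)))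
               - 1 / (2 * \<alpha>) * (v0 \<bullet> v0) - \<beta> * (\<Sum>i\<in>UNIV. v0 $ i))"
      using G_star_eq[OF \<open>\<alpha> > 0\<close>] by blast
  qed (simp_all only: J_E J_star_hat J1_star_hat inf_ball \<open>r > 0\<close> J1_star_def[symmetric])
qed

end
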